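(* Let $n$ be even and let $\mathcal{S}_{\mathrm{int}}=\{[a,a+n/2]: a=1,\ldots,n/2\}\subseteq 2^{[n]}$. Suppose $\mathcal{A}$ is a (randomized) one-pass streaming algorithm that solves the $\alpha$-approximation subset-$\ell_p$ problem with respect to $\mathcal{S}_{\mathrm{int}}$ for some $\alpha\ge1$ and some $p\ge0$, in the sliding-window model with window size $W\ge1$. Then for some sliding-window stream input, $\mathcal{A}$ uses $\Omega(\min(n,W))$ bits of space.
   Context: In the sliding-window model with window size $W$, the stream consists of additive updates to coordinates of a vector, and the input vector $v\in\mathbb{R}^n$ at any time $t$ is determined by only the last $W$ updates (older updates expire). Subsets are identified with $0/1$ vectors; $u\circ v$ is the coordinatewise product; $\|v\|_0$ is the number of nonzero coordinates and $\|v\|_p=(\sum_i|v_i|^p)^{1/p}$ for $p>0$. The $\alpha$-approximation subset-$\ell_p$ problem w.r.t. $\mathcal{S}$: the algorithm (with $\mathcal{S}$ known in advance) outputs a function $E:\mathcal{S}\to\mathbb{R}$ with $\Pr[\|v\circ s\|_p\le E(s)\le\alpha\|v\circ s\|_p]\ge0.9$ for every $s\in\mathcal{S}$, where $v$ is the current (windowed) vector. *)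

theory Defs
  imports "HOL-Probability.Probability"
begin

text \<open>Vectors in \<open>\<real>\<^sup>n\<close> are functions \<open>nat \<Rightarrow> real\<close>, of which only the coordinates in \<open>{1..n}\<close> matter.\<close>

definition lp_norm :: "nat \<Rightarrow> real \<Rightarrow> (nat \<Rightarrow> real) \<Rightarrow> real" where
  "lp_norm n p v =
     (if p = 0 then real (card {i \<in> {1..n}. v i \<noteq> 0})
      else (\<Sum>i = 1..n. \<bar>v i\<bar> powr p) powr (1 / p))"

definition restrict_vec :: "(nat \<Rightarrow> real) \<Rightarrow> nat set \<Rightarrow> nat \<Rightarrow> real" where
  "restrict_vec v s = (\<lambda>i. v i * indicator s i)"

definition S_int :: "nat \<Rightarrow> nat set set" where
  "S_int n = (\<lambda>a. {a..a + n div 2}) ` {1..n div 2}"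


text \<open>The pair \<open>(i, \<delta>)\<close> is the update \<open>v\<^sub>i := v\<^sub>i + \<delta>\<close>; the set \<open>U\<close> consists of the admissible
  increments \<open>\<delta>\<close>.\<close>

type_synonym update = "nat \<times> real"

definition update_streams :: "nat \<Rightarrow> real set \<Rightarrow> update list set" where
  "update_streams n U = lists ({1..n} \<times> U)"

definition window :: "nat \<Rightarrow> update list \<Rightarrow> update list" where
  "window W xs = drop (length xs - W) xs"

definition window_vec :: "nat \<Rightarrow> update list \<Rightarrow> nat \<Rightarrow> real" where
  "window_vec W xs i = (\<Sum>(j, \<delta>)\<leftarrow>window W xs. if j = i then \<delta> else 0)"


text \<open>A randomized one-pass algorithm. The memory is a bit string. The random tape and the number
  of updates read so far are available at every step and are not charged to the space; hence
  algorithms with shared randomness, with fresh coins at each step, or with access to a clock are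
  all covered. No uniformity or computability is required.\<close>

type_synonym tape = "nat \<Rightarrow> bool"

record stream_alg =
  coins :: "tape measure"
  start :: "tape \<Rightarrow> bool list"
  step :: "tape \<Rightarrow> nat \<Rightarrow> bool list \<Rightarrow> update \<Rightarrow> bool list"
  answer :: "tape \<Rightarrow> nat \<Rightarrow> bool list \<Rightarrow> nat set \<Rightarrow> real"

definition memory :: "stream_alg \<Rightarrow> tape \<Rightarrow> update list \<Rightarrow> bool list" where
  "memory A \<omega> xs =
     fold (\<lambda>(t, u) \<sigma>. step A \<omega> t \<sigma> u) (List.enumerate 0 xs) (start A \<omega>)"

definition estimate :: "stream_alg \<Rightarrow> tape \<Rightarrow> update list \<Rightarrow> nat set \<Rightarrow> real" where
  "estimate A \<omega> xs = answer A \<omega> (length xs) (memory A \<omega> xs)"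

definition bits_used :: "stream_alg \<Rightarrow> tape \<Rightarrow> update list \<Rightarrow> nat" where
  "bits_used A \<omega> xs = Max ((\<lambda>t. length (memory A \<omega> (take t xs))) ` {..length xs})"

text \<open>Worst-case space over the coin tosses, up to null events: \<open>A\<close> uses at least \<open>b\<close> bits on \<open>xs\<close>
  unless it almost surely uses fewer.\<close>

definition uses_bits :: "stream_alg \<Rightarrow> update list \<Rightarrow> real \<Rightarrow> bool" where
  "uses_bits A xs b \<longleftrightarrow> \<not> (AE \<omega> in coins A. real (bits_used A \<omega> xs) < b)"

text \<open>The guarantee is required after every finite stream, that is, at every time. A non-measurable
  event has \<^const>\<open>measure\<close> \<open>0\<close>, so measurability of the event is part of the requirement.\<close>

definition solves_subset_lp ::
  "nat \<Rightarrow> real set \<Rightarrow> nat \<Rightarrow> real \<Rightarrow> real \<Rightarrow> nat set set \<Rightarrow> stream_alg \<Rightarrow> bool" where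
  "solves_subset_lp n U W \<alpha> p \<S> A \<longleftrightarrow>
     prob_space (coins A) \<and>
     (\<forall>xs \<in> update_streams n U. \<forall>s \<in> \<S>.
        measure (coins A)
          {\<omega> \<in> space (coins A).
             lp_norm n p (restrict_vec (window_vec W xs) s) \<le> estimate A \<omega> xs s \<and>
             estimate A \<omega> xs s \<le> \<alpha> * lp_norm n p (restrict_vec (window_vec W xs) s)}
        \<ge> 9 / 10)"

end

theory Submission
  imports Defs
begin

text \<open>The problem contains the one-way communication problem INDEX. Put \<open>m = min (n/2) W\<close> and write a
  set \<open>x \<subseteq> {1..m}\<close> into the stream in the order \<open>m, \<dots>, 1\<close>. After \<open>W - j\<close> further zero updates only the
  coordinates \<open>1, \<dots>, j\<close> are alive, and of these the interval \<open>[j, j + n/2]\<close> contains \<open>j\<close> alone, so an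
  approximation of the norm, whatever the factor, reveals whether \<open>j \<in> x\<close>. Hence the memory after
  \<open>m\<close> updates determines each bit of \<open>x\<close> with probability \<open>9/10\<close>, and for some tape the average number
  of wrong bits is at most \<open>m/10\<close>. For a fixed tape the average of \<open>t\<close> to the power of the number of
  errors is bounded below by Jensen's inequality and above by the number of memory states
  times \<open>((1 + t)/2)\<^sup>m\<close>.\<close>

section \<open>Counting bound for INDEX\<close>

text \<open>The sum factorises over the elements of \<open>J\<close>: one of the two choices for
  \<open>j\<close> agrees with \<open>y\<close> and has weight 1, the other has weight
  \<open>t\<close>. So the value does not depend on \<open>y\<close>.\<close>

lemma sum_Pow_power_hamming_distance:
  fixes t :: "'b :: comm_semiring_1"
  assumes J: "finite J"
  shows "(\<Sum>x\<in>Pow J. t ^ card {j \<in> J. (j \<in> x) \<noteq> (j \<in> y)}) = (1 + t) ^ card J"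
proof -
  define f g :: "'a \<Rightarrow> 'b" where
    "f j = (if j \<in> y then 1 else t)" and "g j = (if j \<in> y then t else 1)" for j
  have "(1 + t) ^ card J = (\<Prod>j\<in>J. f j + g j)"
    by (simp add: f_def g_def add.commute if_distrib[of "\<lambda>u. u + _"] cong: prod.cong if_cong)
  also have "\<dots> = (\<Sum>x\<in>Pow J. prod f x * prod g (J - x))"
    by (rule prod_add[OF J])
  also have "\<dots> = (\<Sum>x\<in>Pow J. t ^ card {j \<in> J. (j \<in> x) \<noteq> (j \<in> y)})"
  proof (rule sum.cong[OF refl])
    fix x assume "x \<in> Pow J"
    then have x: "x \<subseteq> J" and fin: "finite x" "finite (J - x)"
      using J by (auto intro: finite_subset)
    have "prod f x = (\<Prod>j\<in>x - y. t)"
      using fin by (intro prod.mono_neutral_cong_right) (auto simp: f_def)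
    moreover have "prod g (J - x) = (\<Prod>j\<in>(J - x) \<inter> y. t)"
      using fin by (intro prod.mono_neutral_cong_right) (auto simp: g_def)
    moreover have "{j \<in> J. (j \<in> x) \<noteq> (j \<in> y)} = (x - y) \<union> ((J - x) \<inter> y)"
      using x by auto
    moreover have "card ((x - y) \<union> ((J - x) \<inter> y)) = card (x - y) + card ((J - x) \<inter> y)"
      using fin by (intro card_Un_disjoint) auto
    ultimately show "prod f x * prod g (J - x) = t ^ card {j \<in> J. (j \<in> x) \<noteq> (j \<in> y)}"
      by (simp add: power_add)
  qed
  finally show ?thesis ..
qed

text \<open>The right side is convex in \<open>b\<close> and the left side is its tangent at
  \<open>a\<close>; this is \<open>1 + u \<le> exp u\<close>.\<close>

lemma powr_ge_tangent:
  fixes t :: real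
  assumes "0 < t"
  shows "t powr a * (1 + (b - a) * ln t) \<le> t powr b"
proof -
  have "t powr b = t powr a * exp ((b - a) * ln t)"
    using assms by (simp add: powr_def flip: exp_add) (simp add: algebra_simps)
  then show ?thesis
    using exp_ge_add_one_self[of "(b - a) * ln t"] by (simp add: mult_left_mono)
qed

lemma index_message_count:
  fixes enc :: "'a set \<Rightarrow> 'b" and dec :: "'b \<Rightarrow> 'a set" and t \<delta> :: real
  assumes J: "finite J" and M: "finite M" and enc: "enc ` Pow J \<subseteq> M" and t: "0 < t" "t \<le> 1"
    and err: "(\<Sum>x\<in>Pow J. real (card {j \<in> J. (j \<in> x) \<noteq> (j \<in> dec (enc x))}))
                \<le> 2 ^ card J * (\<delta> * real (card J))"
  shows "2 ^ card J * t powr (\<delta> * real (card J)) \<le> real (card M) * (1 + t) ^ card J"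
proof -
  define e where "e y x = card {j \<in> J. (j \<in> x) \<noteq> (j \<in> (y :: 'a set))}" for x y
  define e0 where "e0 = \<delta> * real (card J)"
  have N: "real (card (Pow J)) = 2 ^ card J"
    using J by (simp add: card_Pow)
  \<comment> \<open>The tangent is taken at the allowed mean error \<open>e0\<close>. The true mean
    is at most \<open>e0\<close> and \<open>ln t \<le> 0\<close>, so the linear terms sum to
    something nonnegative.\<close>
  have "0 \<le> ((\<Sum>x\<in>Pow J. real (e (dec (enc x)) x)) - 2 ^ card J * e0) * ln t"
    using err t by (intro mult_nonpos_nonpos) (auto simp: e_def e0_def)
  then have "t powr e0 * 2 ^ card J
      \<le> t powr e0 * (2 ^ card J + ((\<Sum>x\<in>Pow J. real (e (dec (enc x)) x)) - 2 ^ card J * e0) * ln t)"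
    by (intro mult_left_mono) auto
  also have "\<dots> = (\<Sum>x\<in>Pow J. t powr e0 * (1 + (real (e (dec (enc x)) x) - e0) * ln t))"
    using N by (simp add: sum.distrib sum_subtractf flip: sum_distrib_left sum_distrib_right)
  also have "\<dots> \<le> (\<Sum>x\<in>Pow J. t powr real (e (dec (enc x)) x))"
    using t by (intro sum_mono powr_ge_tangent)
  also have "\<dots> = (\<Sum>x\<in>Pow J. t ^ e (dec (enc x)) x)"
    using t by (simp add: powr_realpow)
  \<comment> \<open>The message actually sent is one of those in \<open>M\<close>. Summing over all
    of them makes the decoded set independent of \<open>x\<close>, so the product formula applies to
    each \<open>\<sigma>\<close>.\<close>
  also have "\<dots> \<le> (\<Sum>x\<in>Pow J. \<Sum>\<sigma>\<in>M. t ^ e (dec \<sigma>) x)"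
    using t M enc by (intro sum_mono member_le_sum) auto
  also have "\<dots> = (\<Sum>\<sigma>\<in>M. \<Sum>x\<in>Pow J. t ^ e (dec \<sigma>) x)"
    by (rule sum.swap)
  also have "\<dots> = real (card M) * (1 + t) ^ card J"
    unfolding e_def sum_Pow_power_hamming_distance[OF J] by simp
  finally show ?thesis
    by (simp add: e0_def mult.commute)
qed

lemma bitstrings_shorter_than:
  fixes b :: real
  shows "finite {l :: bool list. real (length l) < b}" (is "finite ?M")
    and "0 \<le> b \<Longrightarrow> real (card {l :: bool list. real (length l) < b}) \<le> 4 powr b"
proof -
  define L where "L = nat (\<lceil>b\<rceil> - 1)"
  have sub: "?M \<subseteq> {l. set l \<subseteq> UNIV \<and> length l \<le> L}"
    unfolding L_def by (auto; linarith)
  have fin: "finite {l :: bool list. set l \<subseteq> UNIV \<and> length l \<le> L}"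
    by (rule finite_lists_length_le) simp
  show "finite ?M"
    using sub fin by (rule finite_subset)
  assume b: "0 \<le> b"
  show "real (card ?M) \<le> 4 powr b"
  proof (cases "b \<le> 1")
    \<comment> \<open>Here only the empty string can qualify, whereas the count
      \<open>2 ^ Suc L\<close> used below could exceed \<open>4 powr b\<close>.\<close>
    case True
    then have "length l = 0" if "real (length l) < b" for l :: "bool list"
      using that by linarith
    then have "?M \<subseteq> {[]}" by auto
    then have "real (card ?M) \<le> 1"
      using card_mono[of "{[]}" ?M] by simp
    also have "\<dots> \<le> 4 powr b"
      using b by (simp add: ge_one_powr_ge_zero)
    finally show ?thesis .
  next
    case False
    have "card ?M \<le> (\<Sum>i\<le>L. 2 ^ i)"
      using card_mono[OF fin sub] card_lists_length_le[of "UNIV :: bool set" L] by simp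
    also have "\<dots> \<le> 2 ^ Suc L"
      by (induction L) auto
    finally have "real (card ?M) \<le> 2 ^ Suc L"
      by (metis of_nat_le_iff of_nat_numeral of_nat_power)
    also have "\<dots> = 2 powr (real L + 1)"
      by (simp add: powr_realpow powr_add)
    also have "\<dots> \<le> 2 powr (2 * b)"
    proof (rule powr_mono)
      \<comment> \<open>\<open>L\<close> is the largest integer below \<open>b\<close>, so
        \<open>L + 1 < b + 1\<close>, and \<open>1 < b\<close>.\<close>
      show "real L + 1 \<le> 2 * b"
        using False unfolding L_def by linarith
    qed simp
    also have "\<dots> = 4 powr b"
      by (simp flip: powr_powr)
    finally show ?thesis .
  qed
qed

text \<open>Contradicts \<open>index_message_count\<close> at \<open>t = 1/4\<close> and error rate
  1/10 when there are at most \<open>4 powr (m / 5)\<close> messages. After taking logarithms it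
  amounts to \<open>(5/4)^5 < 4\<close>.\<close>

lemma index_rate_gap:
  assumes "0 < m"
  shows "4 powr (real m / 5) * (5 / 4) ^ m < (2 :: real) ^ m * (1 / 4) powr (real m / 10)"
proof -
  have "5 * ln (5 / 4 :: real) = ln ((5 / 4) ^ 5)"
    by (simp add: ln_realpow)
  also have "\<dots> < ln (2 ^ 2)"
    by (subst ln_less_cancel_iff) (auto simp: power_divide)
  also have "\<dots> = 2 * ln (2 :: real)"
    by (subst ln_realpow) auto
  finally have gap: "5 * ln (5 / 4 :: real) < 2 * ln 2" .
  have ln4: "ln (4 :: real) = 2 * ln 2"
    using ln_realpow[of 2 2] by simp
  have "ln (4 powr (real m / 5) * (5 / 4) ^ m) = real m * (2 / 5 * ln 2 + ln (5 / 4 :: real))"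
    by (simp add: ln_mult ln_powr ln_realpow ln4 algebra_simps)
  also have "\<dots> < real m * (4 / 5 * ln 2)"
    using gap assms by (intro mult_strict_left_mono) auto
  also have "\<dots> = ln ((2 :: real) ^ m * (1 / 4) powr (real m / 10))"
    by (simp add: ln_mult ln_powr ln_realpow ln_div ln4 algebra_simps)
  finally show ?thesis
    by (subst (asm) ln_less_cancel_iff) auto
qed

section \<open>Fixing the random tape\<close>

text \<open>The expected number of events that occur is at least \<open>c * card I\<close>, so this
  value is reached on a set that is not null, and \<open>P\<close> excludes only a null set.\<close>

lemma (in prob_space) exists_outcome_with_few_failures:
  fixes c :: real
  assumes I: "finite I"
    and E: "\<And>i. i \<in> I \<Longrightarrow> E i \<in> events" "\<And>i. i \<in> I \<Longrightarrow> c \<le> prob (E i)"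
    and P: "AE \<omega> in M. P \<omega>"
  obtains \<omega> where "\<omega> \<in> space M" "P \<omega>" "real (card {i \<in> I. \<omega> \<notin> E i}) \<le> (1 - c) * real (card I)"
proof -
  define f :: "'a \<Rightarrow> real" where "f \<omega> = (\<Sum>i\<in>I. indicator (E i) \<omega>)" for \<omega>
  have int: "integrable M f"
    unfolding f_def using E(1) by (intro Bochner_Integration.integrable_sum) (auto simp: emeasure_eq_measure)
  have "c * real (card I) \<le> (\<Sum>i\<in>I. prob (E i))"
    using sum_mono[of I "\<lambda>_. c" "\<lambda>i. prob (E i)"] E(2) by (simp add: mult.commute)
  also have "\<dots> = expectation f"
    unfolding f_def using E(1)
    by (subst Bochner_Integration.integral_sum) (auto simp: emeasure_eq_measure)
  finally have "\<not> (AE \<omega> in M. f \<omega> < c * real (card I))"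
    using expectation_less[OF int] by fastforce
  moreover have "AE \<omega> in M. f \<omega> < c * real (card I)"
    if "\<And>\<omega>. \<omega> \<in> space M \<Longrightarrow> P \<omega> \<Longrightarrow> f \<omega> < c * real (card I)"
    using P AE_space by eventually_elim (rule that)
  ultimately obtain \<omega> where \<omega>: "\<omega> \<in> space M" "P \<omega>" "c * real (card I) \<le> f \<omega>"
    by (meson not_le)
  have "f \<omega> = real (card {i \<in> I. \<omega> \<in> E i})"
    unfolding f_def indicator_def using I by (simp add: sum.If_cases Int_def)
  moreover have "card I = card {i \<in> I. \<omega> \<in> E i} + card {i \<in> I. \<omega> \<notin> E i}"
    using I by (subst card_Un_disjoint[symmetric]) (auto intro: arg_cong[where f = card])
  ultimately have "real (card {i \<in> I. \<omega> \<notin> E i}) \<le> (1 - c) * real (card I)"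
    using \<omega>(3) by (simp add: algebra_simps)
  with \<omega> that show thesis by blast
qed

section \<open>Streams that encode sets\<close>

lemma memory_append:
  "memory A \<omega> (xs @ ys) =
     fold (\<lambda>(t, u) \<sigma>. step A \<omega> t \<sigma> u) (List.enumerate (length xs) ys) (memory A \<omega> xs)"
  by (simp add: memory_def enumerate_append_eq)

lemma length_memory_le_bits_used: "length (memory A \<omega> xs) \<le> bits_used A \<omega> xs"
  unfolding bits_used_def by (rule Max_ge) (auto intro: image_eqI[of _ _ "length xs"])

text \<open>Elements outside \<open>x\<close> are written as zero updates, so that the length, and
  with it the clock and the expiry times, does not depend on \<open>x\<close>.\<close>

definition bit_stream :: "nat \<Rightarrow> real \<Rightarrow> nat set \<Rightarrow> update list" where
  "bit_stream m d x = map (\<lambda>i. (i, if i \<in> x then d else 0)) (rev [1..<Suc m])"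

lemma length_bit_stream [simp]: "length (bit_stream m d x) = m"
  by (simp add: bit_stream_def)

lemma bit_stream_in_update_streams:
  assumes "m \<le> n" "0 \<in> U" "d \<in> U"
  shows "bit_stream m d x \<in> update_streams n U"
  using assms by (auto simp: bit_stream_def update_streams_def)

lemma drop_bit_stream:
  assumes "j \<le> m"
  shows "drop (m - j) (bit_stream m d x) = bit_stream j d x"
proof -
  have "drop (m - j) (rev [1..<Suc m]) = rev [1..<Suc j]"
    using assms by (simp add: drop_rev take_upt del: upt_Suc)
  then show ?thesis
    by (simp add: bit_stream_def drop_map del: upt_Suc)
qed

lemma sum_list_bit_stream:
  "(\<Sum>(k, \<delta>)\<leftarrow>bit_stream j d x. if k = i then \<delta> else 0) = (if i \<in> {1..j} \<inter> x then d else 0)"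
  by (induction j) (auto simp: bit_stream_def)

lemma window_vec_bit_stream:
  assumes "j \<le> m" "m \<le> W"
  shows "window_vec W (bit_stream m d x @ replicate (W - j) (1, 0)) i =
           (if i \<in> {1..j} \<inter> x then d else 0)"
proof -
  \<comment> \<open>The total length is \<open>m + (W - j)\<close>, so exactly the first
    \<open>m - j\<close> updates expire.\<close>
  have "window W (bit_stream m d x @ replicate (W - j) (1, 0)) =
          bit_stream j d x @ replicate (W - j) (1, 0)"
    using assms by (simp add: window_def flip: drop_bit_stream)
  then show ?thesis
    by (simp add: window_vec_def sum_list_bit_stream sum_list_replicate)
qed

lemma lp_norm_single:
  assumes "0 \<le> p" "j \<in> {1..n}"
  shows "lp_norm n p (\<lambda>i. if i = j then d else 0) = (if p = 0 then of_bool (d \<noteq> 0) else \<bar>d\<bar>)"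
proof (cases "p = 0")
  case True
  have "{i \<in> {1..n}. (if i = j then d else 0) \<noteq> 0} = (if d = 0 then {} else {j})"
    using assms by auto
  then show ?thesis
    using True by (simp add: lp_norm_def)
next
  case False
  have "(\<Sum>i = 1..n. \<bar>if i = j then d else 0\<bar> powr p) = (\<Sum>i = 1..n. if i = j then \<bar>d\<bar> powr p else 0)"
    by (rule sum.cong) auto
  then show ?thesis
    using False assms by (simp add: lp_norm_def powr_powr)
qed

lemma lp_norm_isolated_bit:
  assumes "1 \<le> j" "j \<le> m" "m \<le> W" "m \<le> n" "0 \<le> p"
  shows "lp_norm n p (restrict_vec
             (window_vec W (bit_stream m d x @ replicate (W - j) (1, 0))) {j..j + h})
           = (if j \<in> x then if p = 0 then of_bool (d \<noteq> 0) else \<bar>d\<bar> else 0)"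
proof -
  have "restrict_vec (window_vec W (bit_stream m d x @ replicate (W - j) (1, 0))) {j..j + h}
          = (\<lambda>i. if i = j then if j \<in> x then d else 0 else 0)"
    unfolding restrict_vec_def window_vec_bit_stream[OF assms(2,3)] fun_eq_iff
    using assms by (auto simp: indicator_def)
  then show ?thesis
    using assms lp_norm_single[of p j n "if j \<in> x then d else 0"] by auto
qed

section \<open>Reduction from INDEX\<close>

theorem mainTheorem4:
  shows "\<exists>c::real. c > 0 \<and>
    (\<forall>(n::nat) (W::nat) (\<alpha>::real) (p::real) (U::real set) (A::stream_alg).
       even n \<longrightarrow> W \<ge> 1 \<longrightarrow> \<alpha> \<ge> 1 \<longrightarrow> p \<ge> 0 \<longrightarrow> 0 \<in> U \<longrightarrow> U \<noteq> {0} \<longrightarrow>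
       solves_subset_lp n U W \<alpha> p (S_int n) A \<longrightarrow>
       (\<exists>xs \<in> update_streams n U. uses_bits A xs (c * real (min n W))))"
\<comment> \<open>As \<open>min n W \<le> 2 * m\<close> for \<open>m = min (n div 2) W\<close>, the
  constant 1/10 puts the assumed space below \<open>m / 5\<close> bits.\<close>
proof (intro exI[of _ "1/10"] conjI allI impI)
  fix n W :: nat and \<alpha> p :: real and U :: "real set" and A :: stream_alg
  assume n: "even n" and W: "W \<ge> 1" and \<alpha>: "\<alpha> \<ge> 1" and p: "p \<ge> 0" and U: "0 \<in> U" "U \<noteq> {0}"
    and A: "solves_subset_lp n U W \<alpha> p (S_int n) A"
  interpret prob_space "coins A"
    using A by (simp add: solves_subset_lp_def)
  define b where "b = 1 / 10 * real (min n W)"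
  show "\<exists>xs \<in> update_streams n U. uses_bits A xs (1 / 10 * real (min n W))"
  proof (rule ccontr)
    assume "\<not> ?thesis"
    then have space: "AE \<omega> in coins A. real (bits_used A \<omega> xs) < b" if "xs \<in> update_streams n U" for xs
      using that by (auto simp: uses_bits_def b_def)
    obtain d where d: "d \<in> U" "d \<noteq> 0"
      using U by auto
    define m where "m = min (n div 2) W"
    have m: "m \<le> n div 2" "m \<le> W" "m \<le> n"
      by (auto simp: m_def)
    have b: "0 \<le> b" "b \<le> real m / 5"
      using n by (auto simp: b_def m_def elim!: evenE)
    \<comment> \<open>For \<open>m = 0\<close> also \<open>b = 0\<close>, and no run uses fewer than
      0 bits.\<close>
    have "m \<noteq> 0"
    proof
      assume "m = 0"
      then have "AE \<omega> in coins A. False"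
        using b space[of "[]"] by (auto simp: update_streams_def)
      then show False by simp
    qed
    then have "n \<noteq> 0"
      by (auto simp: m_def)

    define J where "J = {1..m}"
    define xs where "xs x = bit_stream m d x" for x
    define ys where "ys x j = xs x @ replicate (W - j) (1, 0)" for x j
    define s where "s j = {j..j + n div 2}" for j :: nat
    define E where "E = (\<lambda>(x, j). {\<omega> \<in> space (coins A).
      lp_norm n p (restrict_vec (window_vec W (ys x j)) (s j)) \<le> estimate A \<omega> (ys x j) (s j) \<and>
      estimate A \<omega> (ys x j) (s j) \<le> \<alpha> * lp_norm n p (restrict_vec (window_vec W (ys x j)) (s j))})"
    \<comment> \<open>The decoder resumes from state \<open>\<sigma>\<close> at time
      \<open>m\<close>, feeds the zero updates for each \<open>j\<close> and tests the answer
      against 0.\<close>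
    define dec where "dec \<omega> \<sigma> = {j. answer A \<omega> (m + (W - j))
      (fold (\<lambda>(t, u) \<sigma>. step A \<omega> t \<sigma> u) (List.enumerate m (replicate (W - j) (1, 0))) \<sigma>) (s j) \<noteq> 0}"
      for \<omega> \<sigma>
    have J: "finite J" "card J = m"
      by (auto simp: J_def)
    have xs: "xs x \<in> update_streams n U" for x
      unfolding xs_def using m U d by (intro bit_stream_in_update_streams)
    have ys: "ys x j \<in> update_streams n U" for x j
      using xs U \<open>n \<noteq> 0\<close> by (auto simp: ys_def update_streams_def)
    have probE: "9 / 10 \<le> prob (E i)" if "i \<in> Pow J \<times> J" for i
      using A ys that m by (auto simp: solves_subset_lp_def E_def S_int_def s_def J_def)
    have measE: "E i \<in> events" if "i \<in> Pow J \<times> J" for i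
    proof (rule ccontr)
      assume "E i \<notin> events"
      then show False
        using probE[OF that] by (simp add: measure_notin_sets)
    qed
    \<comment> \<open>A finite union of null sets is null, so one tape can meet the space bound for
      all \<open>x\<close> at once.\<close>
    have "AE \<omega> in coins A. \<forall>x\<in>Pow J. real (bits_used A \<omega> (xs x)) < b"
      using J xs by (intro AE_finite_allI space) auto
    then obtain \<omega> where \<omega>: "\<omega> \<in> space (coins A)" "\<And>x. x \<in> Pow J \<Longrightarrow> real (bits_used A \<omega> (xs x)) < b"
      and fail: "real (card {i \<in> Pow J \<times> J. \<omega> \<notin> E i}) \<le> (1 - 9 / 10) * real (card (Pow J \<times> J))"
      using measE probE J
      by (elim exists_outcome_with_few_failures[of "Pow J \<times> J" E "9 / 10", rotated 3]) auto

    have decode: "j \<in> x \<longleftrightarrow> j \<in> dec \<omega> (memory A \<omega> (xs x))" if "j \<in> J" "\<omega> \<in> E (x, j)" for x j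
    proof -
      have "estimate A \<omega> (ys x j) (s j) \<noteq> 0 \<longleftrightarrow> j \<in> dec \<omega> (memory A \<omega> (xs x))"
        by (simp add: dec_def estimate_def ys_def memory_append) (simp add: xs_def)
      moreover have "lp_norm n p (restrict_vec (window_vec W (ys x j)) (s j))
          = (if j \<in> x then if p = 0 then 1 else \<bar>d\<bar> else 0)"
        using that m p d unfolding ys_def xs_def s_def J_def by (subst lp_norm_isolated_bit) auto
      \<comment> \<open>A zero norm squeezes the estimate to 0 for every \<open>\<alpha>\<close>; a
        positive norm bounds it away from 0.\<close>
      ultimately show ?thesis
        using that(2) d by (auto simp: E_def split: if_splits)
    qed

    have "(\<Sum>x\<in>Pow J. card {j \<in> J. (j \<in> x) \<noteq> (j \<in> dec \<omega> (memory A \<omega> (xs x)))})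
        \<le> (\<Sum>x\<in>Pow J. card {j \<in> J. \<omega> \<notin> E (x, j)})"
      \<comment> \<open>Every wrongly decoded bit comes from a pair \<open>(x, j)\<close> at which
        the guarantee fails.\<close>
      using J decode by (intro sum_mono card_mono) auto
    also have "\<dots> = card (SIGMA x:Pow J. {j \<in> J. \<omega> \<notin> E (x, j)})"
      using J by (subst card_SigmaI) auto
    also have "(SIGMA x:Pow J. {j \<in> J. \<omega> \<notin> E (x, j)}) = {i \<in> Pow J \<times> J. \<omega> \<notin> E i}"
      by auto
    finally have "(\<Sum>x\<in>Pow J. real (card {j \<in> J. (j \<in> x) \<noteq> (j \<in> dec \<omega> (memory A \<omega> (xs x)))}))
        \<le> real (card {i \<in> Pow J \<times> J. \<omega> \<notin> E i})"
      unfolding of_nat_sum[symmetric] of_nat_le_iff .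
    also have "\<dots> \<le> 2 ^ card J * (1 / 10 * real (card J))"
      using fail J by (simp add: card_cartesian_product card_Pow)
    finally have err: "(\<Sum>x\<in>Pow J. real (card {j \<in> J. (j \<in> x) \<noteq> (j \<in> dec \<omega> (memory A \<omega> (xs x)))}))
        \<le> 2 ^ card J * (1 / 10 * real (card J))" .

    define M where "M = {l :: bool list. real (length l) < b}"
    have enc: "(\<lambda>x. memory A \<omega> (xs x)) ` Pow J \<subseteq> M"
    proof (rule image_subsetI)
      fix x assume "x \<in> Pow J"
      then have "real (bits_used A \<omega> (xs x)) < b"
        by (rule \<omega>(2))
      then show "memory A \<omega> (xs x) \<in> M"
        using length_memory_le_bits_used[of A \<omega> "xs x"] by (simp add: M_def)
    qed
    have "2 ^ m * (1 / 4) powr (1 / 10 * real m) \<le> real (card M) * (1 + 1 / 4) ^ m"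
      using index_message_count[OF J(1) _ enc, of "1/4" "dec \<omega>" "1/10"] err J(2)
        bitstrings_shorter_than(1)[of b] by (simp add: M_def)
    also have "\<dots> \<le> 4 powr (real m / 5) * (1 + 1 / 4) ^ m"
    proof (rule mult_right_mono)
      show "real (card M) \<le> 4 powr (real m / 5)"
        unfolding M_def using b by (intro order_trans[OF bitstrings_shorter_than(2)] powr_mono) auto
    qed simp
    finally show False
      using index_rate_gap[of m] \<open>m \<noteq> 0\<close> by simp
  qed
qed simp

end
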